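(* Let $l\ge 2$ be a fixed integer and let $e=e_n$ satisfy $e/n\to\infty$ and $e\le n^2/4$. Then $$ex(n,e,P_l,K_3)=(1+o(1))\,N(P_l,B^e_n)\qquad(n\to\infty).$$
   Context: $P_l$ is the path on $l$ vertices and $K_3$ the triangle. For graphs $H,G$, $N(H,G)$ is the number of subgraphs of $G$ isomorphic to $H$. $ex(n,e,H,F)$ denotes the maximum of $N(H,G)$ over all $F$-free graphs $G$ with $n$ vertices and $e$ edges. For positive integers $n,e$ with $e\le n^2/4$, let $t$ be the smallest positive integer $i$ with $i(n-i)\ge e$; $B^e_n$ is obtained from the complete bipartite graph $K_{t,n-t}$ by picking a vertex of degree $n-t$ and deleting $t(n-t)-e$ of its edges. *)

theory Defs
  imports Complex_Main "HOL-Library.Ramsey" "HOL-Library.Landau_Symbols"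
begin

type_synonym 'a ugraph = "'a set \<times> 'a set set"

abbreviation verts :: "'a ugraph \<Rightarrow> 'a set" where "verts \<equiv> fst"
abbreviation edges :: "'a ugraph \<Rightarrow> 'a set set" where "edges \<equiv> snd"

definition simple_graph :: "'a ugraph \<Rightarrow> bool" where
  "simple_graph G \<longleftrightarrow> finite (verts G) \<and> edges G \<subseteq> nsets (verts G) 2"

definition subgraph :: "'a ugraph \<Rightarrow> 'a ugraph \<Rightarrow> bool" where
  "subgraph H G \<longleftrightarrow> simple_graph H \<and> verts H \<subseteq> verts G \<and> edges H \<subseteq> edges G"

definition graph_iso :: "'a ugraph \<Rightarrow> 'b ugraph \<Rightarrow> bool" where
  "graph_iso G H \<longleftrightarrow> (\<exists>f. bij_betw f (verts G) (verts H) \<and> edges H = (\<lambda>X. f ` X) ` edges G)"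

text \<open>Copies are subgraphs that need not be induced, and they are counted as subgraphs, not as
  embeddings.\<close>

definition num_copies :: "'a ugraph \<Rightarrow> 'b ugraph \<Rightarrow> nat" where
  "num_copies H G = card {G'. subgraph G' G \<and> graph_iso H G'}"

definition graph_free :: "'a ugraph \<Rightarrow> 'b ugraph \<Rightarrow> bool" where
  "graph_free F G \<longleftrightarrow> (\<nexists>G'. subgraph G' G \<and> graph_iso F G')"

definition free_graphs :: "nat \<Rightarrow> nat \<Rightarrow> 'a ugraph \<Rightarrow> nat ugraph set" where
  "free_graphs n e F =
    {G. simple_graph G \<and> card (verts G) = n \<and> card (edges G) = e \<and> graph_free F G}"

text \<open>Every finite graph is isomorphic to one with vertices in \<^typ>\<open>nat\<close>. The set below is finite
  by \<open>finite_num_copies_free_graphs\<close>, but \<^const>\<open>Max\<close> is unspecified if \<^term>\<open>free_graphs n e F\<close>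
  is empty.\<close>

definition ex_count :: "nat \<Rightarrow> nat \<Rightarrow> 'a ugraph \<Rightarrow> 'b ugraph \<Rightarrow> nat" where
  "ex_count n e H F = Max (num_copies H ` free_graphs n e F)"

definition path_graph :: "nat \<Rightarrow> nat ugraph" where
  "path_graph l = ({..<l}, {{i, Suc i} | i. Suc i < l})"

definition complete_graph :: "nat \<Rightarrow> nat ugraph" where
  "complete_graph r = ({..<r}, nsets {..<r} 2)"

definition B_t :: "nat \<Rightarrow> nat \<Rightarrow> nat" where
  "B_t n e = (LEAST i. 0 < i \<and> e \<le> i * (n - i))"

text \<open>The parts of \<open>K\<^bsub>t,n-t\<^esub>\<close> are \<open>{..<t}\<close> and \<open>{t..<n}\<close>. The chosen vertex of degree \<open>n - t\<close> is
  \<open>0\<close>, and the deleted edges join it to the first \<open>t(n - t) - e\<close> vertices of the other part;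
  all other choices give isomorphic graphs.\<close>

definition B_graph :: "nat \<Rightarrow> nat \<Rightarrow> nat ugraph" where
  "B_graph n e = (let t = B_t n e in
     ({..<n}, {{a, b} | a b. a < t \<and> t \<le> b \<and> b < n} - {{0, t + j} | j. j < t * (n - t) - e}))"

lemma finite_num_copies_free_graphs:
  "finite (num_copies H ` free_graphs n e F)"
proof (rule finite_subset)
  show "num_copies H ` free_graphs n e F \<subseteq> {..2 ^ n * 2 ^ e}"
  proof clarsimp
    fix V :: "nat set" and E assume "(V, E) \<in> free_graphs n e F"
    then have V: "finite V" "card V = n" and E: "card E = e" "E \<subseteq> nsets V 2"
      by (auto simp: free_graphs_def simple_graph_def)
    then have fE: "finite E" by (meson finite_imp_finite_nsets finite_subset)
    have "num_copies H (V, E) \<le> card (Pow V \<times> Pow E)"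
      unfolding num_copies_def by (rule card_mono) (use V fE in \<open>auto simp: subgraph_def\<close>)
    then show "num_copies H (V, E) \<le> 2 ^ n * 2 ^ e"
      using V E fE by (simp add: card_cartesian_product card_Pow)
  qed
qed auto

end

theory Submission
  imports Defs "HOL-Real_Asymp.Real_Asymp"
begin

text \<open>In a triangle-free graph with \<open>e\<close> edges, a vertex \<open>x\<close> is adjacent to at most one end of any
  edge, so a walk from \<open>x\<close> with \<open>2k\<close> further vertices is determined by the \<open>k\<close> edges formed by
  consecutive pairs of these vertices; hence there are at most \<open>e\<^sup>k\<close> such walks. Summing over
  the first vertex or the first oriented edge, there are at most \<open>n e\<^sup>k\<close> walks with
  \<open>2k + 1\<close> vertices and \<open>2 e\<^sup>k\<close> walks with \<open>2k\<close> vertices, and every path is two walks. On the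
  other hand \<open>B\<^bsup>e\<^esup>\<^bsub>n\<^esub>\<close> contains \<open>K\<^bsub>t-1,n-t\<^esub>\<close> where \<open>t (n - t) \<ge> e\<close>, and both \<open>t\<close> and \<open>n - t\<close> tend
  to infinity, so counting alternating paths attains the bound asymptotically.\<close>

section \<open>Paths as lists\<close>

definition list_edges :: "'a list \<Rightarrow> 'a set set" where
  "list_edges xs = {{xs ! i, xs ! Suc i} | i. Suc i < length xs}"

text \<open>A path copy is encoded by its vertex sequence, which turns counting subgraphs into
  counting lists: for \<open>l\<close> at least 2 each copy comes from exactly two lists, one per
  direction.\<close>

definition path_lists :: "'a ugraph \<Rightarrow> nat \<Rightarrow> 'a list set" where
  "path_lists G l =
    {xs. length xs = l \<and> distinct xs \<and> set xs \<subseteq> verts G \<and> list_edges xs \<subseteq> edges G}"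

lemma list_edges_Nil [simp]: "list_edges [] = {}"
  and list_edges_single [simp]: "list_edges [x] = {}"
  by (auto simp: list_edges_def)

lemma list_edges_Cons2 [simp]:
  "list_edges (x # y # zs) = insert {x, y} (list_edges (y # zs))"
proof -
  have "{i. Suc i < length (x # y # zs)} = insert 0 (Suc ` {i. Suc i < length (y # zs)})"
    by (auto simp: image_iff gr0_conv_Suc less_Suc_eq_0_disj)
  then show ?thesis
    unfolding list_edges_def setcompr_eq_image by (simp add: image_image)
qed

lemma list_edges_rev: "list_edges (rev xs) = list_edges xs"
proof -
  have "list_edges xs \<subseteq> list_edges (rev xs)" for xs :: "'a list"
  proof
    fix X assume "X \<in> list_edges xs"
    then obtain i where i: "Suc i < length xs" "X = {xs ! i, xs ! Suc i}"
      by (auto simp: list_edges_def)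
    \<comment> \<open>Reversal moves the edge at positions \<open>i\<close>, \<open>Suc i\<close> to
      positions \<open>j\<close>, \<open>Suc j\<close>, where \<open>j\<close> is the number of
      entries after it.\<close>
    define j where "j = length xs - Suc (Suc i)"
    have "Suc j < length (rev xs)" "rev xs ! j = xs ! Suc i" "rev xs ! Suc j = xs ! i"
      using i by (auto simp: j_def rev_nth Suc_diff_Suc)
    then show "X \<in> list_edges (rev xs)"
      using i unfolding list_edges_def by (auto simp: insert_commute intro!: exI[of _ j])
  qed
  from this[of xs] this[of "rev xs"] show ?thesis by auto
qed

lemma list_edges_subset_set: "X \<in> list_edges xs \<Longrightarrow> X \<subseteq> set xs"
  by (auto simp: list_edges_def)

lemma list_edges_append_mid: "{u, v} \<in> list_edges (us @ u # v # vs)"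
  unfolding list_edges_def by (auto simp: nth_append intro!: exI[of _ "length us"])

lemma list_edges_map_upt:
  "list_edges (map f [0..<l]) = (\<lambda>X. f ` X) ` {{i, Suc i} | i. Suc i < l}"
proof -
  have "list_edges (map f [0..<l]) = {{f i, f (Suc i)} | i. Suc i < l}"
    unfolding list_edges_def
    by (auto simp: nth_append) (metis add.left_neutral Suc_lessD nth_map nth_upt length_upt diff_zero)+
  then show ?thesis
    unfolding setcompr_eq_image by (simp add: image_image)
qed

text \<open>Since \<open>x\<close> does not recur, only the first edge contains it. That edge
  determines the second vertex, and removing it leaves the edge sets of the tails, to which the
  induction hypothesis applies.\<close>

lemma list_edges_inj_same_hd:
  assumes "distinct (x # xs)" "distinct (x # ys)" "length xs = length ys"
    "list_edges (x # xs) = list_edges (x # ys)"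
  shows "xs = ys"
  using assms(3,1,2,4)
proof (induction xs ys arbitrary: x rule: list_induct2)
  case (Cons a xs b ys)
  have xa: "x \<notin> X" if "X \<in> list_edges (a # xs)" for X
    using list_edges_subset_set[OF that] Cons.prems(1) by auto
  have xb: "x \<notin> X" if "X \<in> list_edges (b # ys)" for X
    using list_edges_subset_set[OF that] Cons.prems(2) by auto
  have eq: "insert {x, a} (list_edges (a # xs)) = insert {x, b} (list_edges (b # ys))"
    using Cons.prems(3) by simp
  then have "{x, a} \<in> insert {x, b} (list_edges (b # ys))" by blast
  then have ab: "a = b" using xb by (auto simp: doubleton_eq_iff)
  have "list_edges (a # xs) = list_edges (b # ys)"
    using eq xa xb unfolding ab by blast
  then show ?case using Cons ab by auto
qed simp

text \<open>The first vertex \<open>x\<close> of \<open>xs\<close> lies in at most one edge, whereas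
  an interior vertex of \<open>ys\<close> has two distinct neighbours. So \<open>x\<close> is an end
  of \<open>ys\<close>, and either \<open>ys\<close> or its reversal has the same head as
  \<open>xs\<close>.\<close>

lemma list_edges_inj_up_to_rev:
  assumes "distinct xs" "distinct ys" "length xs = length ys" "set xs = set ys"
    "list_edges xs = list_edges ys"
  shows "ys = xs \<or> ys = rev xs"
proof (cases xs)
  case Nil
  then show ?thesis using assms by simp
next
  case (Cons x xs')
  have unique: "X = Y" if "X \<in> list_edges xs" "Y \<in> list_edges xs" "x \<in> X" "x \<in> Y" for X Y
  proof (cases xs')
    case Nil
    then show ?thesis using that Cons by simp
  next
    case c: (Cons z zs)
    have "x \<notin> Z" if "Z \<in> list_edges (z # zs)" for Z
      using list_edges_subset_set[OF that] assms(1) Cons c by auto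
    then show ?thesis using that Cons c by auto
  qed
  have "x \<in> set ys" using assms(4) Cons by auto
  then obtain us vs where ys: "ys = us @ x # vs" by (meson split_list)
  consider "us = []" | "vs = []" | "us \<noteq> []" "vs \<noteq> []" by blast
  then show ?thesis
  proof cases
    case 1
    then show ?thesis using list_edges_inj_same_hd[of x xs' vs] assms Cons ys by auto
  next
    case 2
    have "xs' = rev us"
      using list_edges_inj_same_hd[of x xs' "rev us"] assms Cons ys 2 list_edges_rev[of ys] by auto
    then show ?thesis using Cons ys 2 by simp
  next
    case 3
    then obtain us' u v vs' where eq: "us = us' @ [u]" "vs = v # vs'"
      by (metis rev_exhaust list.exhaust)
    have "{u, x} \<in> list_edges ys" "{x, v} \<in> list_edges ys"
      using list_edges_append_mid[of u x us' "v # vs'"] list_edges_append_mid[of x v "us' @ [u]" vs']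
      by (simp_all add: ys eq)
    then have "{u, x} = {x, v}" using unique assms(5) by blast
    then show ?thesis using assms(2) ys eq by (auto simp: doubleton_eq_iff)
  qed
qed

lemma finite_path_lists: "finite (verts G) \<Longrightarrow> finite (path_lists G l)"
  by (rule finite_subset[OF _ finite_lists_length_eq[of "verts G" l]]) (auto simp: path_lists_def)

text \<open>An isomorphism \<open>f\<close> from the path is the same thing as the list of its
  values at 0, ..., \<open>l - 1\<close>; conversely, indexing into a path list is an
  isomorphism.\<close>

lemma path_copies_eq_image:
  "{G'. subgraph G' G \<and> graph_iso (path_graph l) G'}
     = (\<lambda>xs. (set xs, list_edges xs)) ` path_lists G l"
proof (intro equalityI subsetI)
  fix G' assume "G' \<in> {G'. subgraph G' G \<and> graph_iso (path_graph l) G'}"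
  then obtain f where sub: "subgraph G' G" and f: "bij_betw f {..<l} (verts G')"
    and E: "edges G' = (\<lambda>X. f ` X) ` {{i, Suc i} | i. Suc i < l}"
    by (auto simp: graph_iso_def path_graph_def)
  define xs where "xs = map f [0..<l]"
  have "set xs = verts G'" using f by (auto simp: xs_def bij_betw_def lessThan_atLeast0)
  moreover have "list_edges xs = edges G'" by (simp only: xs_def list_edges_map_upt E)
  moreover have "distinct xs" "length xs = l"
    using f by (auto simp: xs_def distinct_map bij_betw_def lessThan_atLeast0)
  ultimately show "G' \<in> (\<lambda>xs. (set xs, list_edges xs)) ` path_lists G l"
    using sub by (intro image_eqI[of _ _ xs]) (auto simp: path_lists_def subgraph_def)
next
  fix G' assume "G' \<in> (\<lambda>xs. (set xs, list_edges xs)) ` path_lists G l"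
  then obtain xs where xs: "length xs = l" "distinct xs" "set xs \<subseteq> verts G" "list_edges xs \<subseteq> edges G"
    and G': "G' = (set xs, list_edges xs)" by (auto simp: path_lists_def)
  have map: "map ((!) xs) [0..<l] = xs" using xs(1) map_nth by blast
  have "list_edges xs \<subseteq> nsets (set xs) 2"
    using xs by (auto simp: list_edges_def nsets_def card_insert_if nth_eq_iff_index_eq)
  moreover have "bij_betw ((!) xs) {..<l} (set xs)"
    using xs by (intro bij_betw_nth) auto
  moreover have "list_edges xs = (\<lambda>X. (!) xs ` X) ` {{i, Suc i} | i. Suc i < l}"
    using list_edges_map_upt[of "(!) xs" l] by (simp only: map)
  ultimately show "G' \<in> {G'. subgraph G' G \<and> graph_iso (path_graph l) G'}"
    using xs by (auto simp: G' subgraph_def simple_graph_def graph_iso_def path_graph_def)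
qed

text \<open>The fibres of the map from path lists to subgraphs are the pairs
  \<open>{xs, rev xs}\<close>. The two lists differ because \<open>l \<ge> 2\<close> makes the first
  and last vertices distinct.\<close>

lemma two_mult_num_path_copies:
  assumes "finite (verts G)" "l \<ge> 2"
  shows "2 * num_copies (path_graph l) G = card (path_lists G l)"
proof -
  let ?P = "path_lists G l" and ?f = "\<lambda>xs. (set xs, list_edges xs)"
  have fibre: "card {xs \<in> ?P. ?f xs = y} = 2" if "y \<in> ?f ` ?P" for y
  proof -
    from that obtain xs where xs: "xs \<in> ?P" "y = ?f xs" by blast
    have "rev xs \<in> ?P" using xs(1) by (auto simp: path_lists_def list_edges_rev)
    moreover have "ys = xs \<or> ys = rev xs" if "ys \<in> ?P" "?f ys = y" for ys
      using that xs by (intro list_edges_inj_up_to_rev) (auto simp: path_lists_def)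
    ultimately have "{ys \<in> ?P. ?f ys = y} = {xs, rev xs}"
      using xs by (auto simp: list_edges_rev)
    moreover have "xs \<noteq> rev xs"
    proof
      assume "xs = rev xs"
      then have "xs ! 0 = xs ! (l - 1)"
        using xs(1) assms(2) rev_nth[of 0 xs] by (auto simp: path_lists_def)
      then show False
        using xs(1) assms(2) nth_eq_iff_index_eq[of xs 0 "l - 1"] by (auto simp: path_lists_def)
    qed
    ultimately show ?thesis by simp
  qed
  have "card ?P = (\<Sum>y \<in> ?f ` ?P. card {xs \<in> ?P. ?f xs = y})"
    using finite_path_lists[OF assms(1)] sum.image_gen[of ?P "\<lambda>_. 1::nat" ?f] by simp
  also have "\<dots> = 2 * card (?f ` ?P)" using fibre by simp
  finally show ?thesis by (simp add: num_copies_def path_copies_eq_image)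
qed

section \<open>Walks in triangle-free graphs\<close>

text \<open>The start \<open>x\<close> stays outside the list, so \<open>m\<close> counts further
  vertices. Repetitions are allowed, so a tail of a walk is again a walk from the vertex before
  it.\<close>

definition walks_from :: "'a set set \<Rightarrow> 'a \<Rightarrow> nat \<Rightarrow> 'a list set" where
  "walks_from E x m = {xs. length xs = m \<and> list_edges (x # xs) \<subseteq> E}"

text \<open>Edges are 2-sets, so the three vertices are distinct, and any bijection from
  \<open>{..<3}\<close> onto them is an isomorphism onto the triangle they span.\<close>

lemma triangle_imp_not_graph_free:
  assumes "simple_graph G" "{x, u} \<in> edges G" "{x, v} \<in> edges G" "{u, v} \<in> edges G"
  shows "\<not> graph_free (complete_graph 3) G"
proof -
  have E: "edges G \<subseteq> nsets (verts G) 2" using assms(1) by (simp add: simple_graph_def)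
  have neq: "x \<noteq> u" "x \<noteq> v" "u \<noteq> v" and V: "{x, u, v} \<subseteq> verts G"
    using assms(2-4) E by (auto simp: nsets_def)
  have sub: "nsets {x, u, v} 2 \<subseteq> edges G"
    using assms(2-4) by (auto simp: nsets_def card_2_iff insert_commute)
  have "card {..<3::nat} = card {x, u, v}" using neq by simp
  then obtain f where f: "bij_betw f {..<3::nat} {x, u, v}"
    using finite_same_card_bij[of "{..<3::nat}" "{x, u, v}"] by auto
  have "graph_iso (complete_graph 3) ({x, u, v}, nsets {x, u, v} 2)"
    unfolding graph_iso_def complete_graph_def
    using f bij_betw_nsets[OF f, of 2] by (intro exI[of _ f]) (auto simp: bij_betw_def)
  moreover have "subgraph ({x, u, v}, nsets {x, u, v} 2) G"
    using V sub by (simp add: subgraph_def simple_graph_def)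
  ultimately show ?thesis unfolding graph_free_def by blast
qed

lemma finite_edges: "simple_graph G \<Longrightarrow> finite (edges G)"
  by (meson simple_graph_def finite_imp_finite_nsets finite_subset)

text \<open>The walks are sorted by the edge \<open>f\<close> formed by their first two further
  vertices. Only one end of \<open>f\<close> can be adjacent to \<open>x\<close>, so
  \<open>f\<close> fixes both vertices in order, and the remaining \<open>2 * k\<close> vertices
  form a walk from the second one. The induction runs over all \<open>x\<close> because the start
  changes.\<close>

lemma card_walks_from_even_le:
  assumes G: "simple_graph G" "graph_free (complete_graph 3) G"
  shows "finite (walks_from (edges G) x (2 * k))
    \<and> card (walks_from (edges G) x (2 * k)) \<le> card (edges G) ^ k"
proof (induction k arbitrary: x)
  case 0
  have "walks_from (edges G) x (2 * 0) = {[]}" by (auto simp: walks_from_def)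
  then show ?case by simp
next
  case (Suc k)
  let ?E = "edges G"
  define L where "L f = {xs \<in> walks_from ?E x (2 * Suc k). {xs ! 0, xs ! 1} = f}" for f
  have fin: "finite ?E" using finite_edges[OF G(1)] .
  have shape: "\<exists>u v ys. xs = u # v # ys \<and> {x, u} \<in> ?E \<and> {u, v} \<in> ?E \<and> ys \<in> walks_from ?E v (2 * k)"
    if "xs \<in> walks_from ?E x (2 * Suc k)" for xs
    using that by (auto simp: walks_from_def length_Suc_conv)
  have cover: "walks_from ?E x (2 * Suc k) = (\<Union>f\<in>?E. L f)"
    using shape by (fastforce simp: L_def)
  have L: "finite (L f) \<and> card (L f) \<le> card ?E ^ k" for f
  proof (cases "L f = {}")
    case False
    then obtain u v ys where 1: "u # v # ys \<in> L f" "{x, u} \<in> ?E" "{u, v} \<in> ?E"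
      using shape by (fastforce simp: L_def)
    have "L f \<subseteq> (\<lambda>ys. u # v # ys) ` walks_from ?E v (2 * k)"
    proof
      fix xs assume xs: "xs \<in> L f"
      then obtain u' v' zs where 2: "xs = u' # v' # zs" "{x, u'} \<in> ?E" "{u', v'} \<in> ?E"
        "zs \<in> walks_from ?E v' (2 * k)"
        using shape[of xs] by (auto simp: L_def)
      have "{u', v'} = {u, v}" using xs 1 2 by (simp add: L_def)
      \<comment> \<open>If \<open>u' = v\<close>, both ends of the edge \<open>{u, v}\<close> would
        be adjacent to \<open>x\<close>, giving a triangle.\<close>
      moreover have "u' \<noteq> v" using triangle_imp_not_graph_free[OF G(1) 1(2) _ 1(3)] G(2) 2 by auto
      ultimately have "u' = u" "v' = v" by (auto simp: doubleton_eq_iff)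
      then show "xs \<in> (\<lambda>ys. u # v # ys) ` walks_from ?E v (2 * k)" using 2 by blast
    qed
    then show ?thesis
      using Suc.IH[of v] by (meson card_image_le card_mono finite_imageI finite_subset le_trans)
  qed simp
  have "card (\<Union>f\<in>?E. L f) \<le> (\<Sum>f\<in>?E. card (L f))" by (rule card_UN_le[OF fin])
  also have "\<dots> \<le> (\<Sum>f\<in>?E. card ?E ^ k)" using L by (intro sum_mono) blast
  finally show ?case unfolding cover using L fin by auto
qed

lemma card_oriented_edges_le:
  assumes "simple_graph G"
  shows "finite {(u, v). {u, v} \<in> edges G} \<and> card {(u, v). {u, v} \<in> edges G} \<le> 2 * card (edges G)"
proof -
  let ?D = "\<lambda>f. {(u, v). {u, v} = f}"
  have D: "finite (?D f) \<and> card (?D f) \<le> 2" if f: "f \<in> edges G" for f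
  proof -
    have "card f = 2" using f assms by (auto simp: simple_graph_def nsets_def)
    then obtain a b where "f = {a, b}" by (auto simp: card_2_iff)
    then have "?D f \<subseteq> {(a, b), (b, a)}" by (auto simp: doubleton_eq_iff)
    moreover have "card {(a, b), (b, a)} \<le> 2" using card_insert_le_m1[of 2 "{(b,a)}" "(a,b)"] by simp
    ultimately show ?thesis by (meson card_mono finite.emptyI finite_insert finite_subset le_trans)
  qed
  have "{(u, v). {u, v} \<in> edges G} = (\<Union>f\<in>edges G. ?D f)" by auto
  moreover have "card (\<Union>f\<in>edges G. ?D f) \<le> (\<Sum>f\<in>edges G. card (?D f))"
    by (rule card_UN_le[OF finite_edges[OF assms]])
  moreover have "(\<Sum>f\<in>edges G. card (?D f)) \<le> (\<Sum>f\<in>edges G. 2)" using D by (intro sum_mono) blast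
  ultimately show ?thesis using D finite_edges[OF assms] by auto
qed

lemma card_Sigma_le_mult:
  assumes "finite A" "\<And>x. x \<in> A \<Longrightarrow> finite (B x) \<and> card (B x) \<le> c"
  shows "finite (Sigma A B)" "card (Sigma A B) \<le> card A * c"
  using assms sum_mono[of A "\<lambda>x. card (B x)" "\<lambda>_. c"] by (auto simp: finite_SigmaI)

text \<open>An even number of vertices must remain for the walk bound. Hence an even path is split
  after its first oriented edge and an odd path after its first vertex.\<close>

lemma num_path_copies_triangle_free_le:
  assumes G: "simple_graph G" "graph_free (complete_graph 3) G" and l: "l \<ge> 2"
  shows "2 * num_copies (path_graph l) G
    \<le> card (edges G) ^ (l div 2) * (if even l then 2 else card (verts G))"
proof -
  let ?E = "edges G"
  have V: "finite (verts G)" using G by (simp add: simple_graph_def)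
  have "card (path_lists G l) \<le> card ?E ^ (l div 2) * (if even l then 2 else card (verts G))"
  proof (cases "even l")
    case True
    then obtain k where k: "l = 2 * Suc k"
      using l by (metis evenE not0_implies_Suc mult_0_right not_numeral_le_zero)
    define S where "S = Sigma {(u, v). {u, v} \<in> ?E} (\<lambda>(u, v). walks_from ?E v (2 * k))"
    have "path_lists G l \<subseteq> (\<lambda>((u, v), ys). u # v # ys) ` S"
    proof
      fix xs assume "xs \<in> path_lists G l"
      then obtain u v ys where "xs = u # v # ys" "((u, v), ys) \<in> S"
        by (auto simp: path_lists_def S_def k walks_from_def length_Suc_conv)
      then show "xs \<in> (\<lambda>((u, v), ys). u # v # ys) ` S" by force
    qed
    moreover have "finite S \<and> card S \<le> card {(u, v). {u, v} \<in> ?E} * card ?E ^ k"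
      unfolding S_def using card_oriented_edges_le[OF G(1)] card_walks_from_even_le[OF G]
      by (intro conjI card_Sigma_le_mult) auto
    ultimately have "card (path_lists G l) \<le> card {(u, v). {u, v} \<in> ?E} * card ?E ^ k"
      by (meson card_image_le card_mono finite_imageI le_trans)
    also have "\<dots> \<le> 2 * card ?E * card ?E ^ k"
      using card_oriented_edges_le[OF G(1)] by (intro mult_right_mono) auto
    finally show ?thesis using True k by (simp add: mult_ac)
  next
    case False
    then obtain k where k: "l = Suc (2 * k)" by (auto elim: oddE)
    define S where "S = Sigma (verts G) (\<lambda>v. walks_from ?E v (2 * k))"
    have "path_lists G l \<subseteq> (\<lambda>(v, ys). v # ys) ` S"
    proof
      fix xs assume "xs \<in> path_lists G l"
      then obtain v ys where "xs = v # ys" "(v, ys) \<in> S"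
        by (auto simp: path_lists_def S_def k walks_from_def length_Suc_conv)
      then show "xs \<in> (\<lambda>(v, ys). v # ys) ` S" by force
    qed
    moreover have "finite S \<and> card S \<le> card (verts G) * card ?E ^ k"
      unfolding S_def using V card_walks_from_even_le[OF G]
      by (intro conjI card_Sigma_le_mult) auto
    ultimately have "card (path_lists G l) \<le> card (verts G) * card ?E ^ k"
      by (meson card_image_le card_mono finite_imageI le_trans)
    then show ?thesis using False k by (simp add: mult_ac)
  qed
  then show ?thesis using two_mult_num_path_copies[OF V l] by simp
qed

section \<open>Alternating paths\<close>

text \<open>Paths are built by prepending vertices from alternating sides. At most \<open>L\<close>
  vertices are in use at any time, so each step has at least the size of its side minus
  \<open>L\<close> choices; keeping \<open>L\<close> fixed makes the loss uniform along the
  induction.\<close>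

lemma card_alternating_paths_ge:
  fixes A B :: "'a set"
  assumes "finite A" "finite B" "\<And>a b. a \<in> A \<Longrightarrow> b \<in> B \<Longrightarrow> {a, b} \<in> E" "m \<le> L"
  shows "(card A - L) ^ ((m + 1) div 2) * (card B - L) ^ (m div 2)
    \<le> card {xs. length xs = m \<and> distinct xs \<and> set xs \<subseteq> A \<union> B \<and> list_edges xs \<subseteq> E
              \<and> (xs \<noteq> [] \<longrightarrow> hd xs \<in> A)}" (is "_ \<le> card (?P A B m)")
  using assms
proof (induction m arbitrary: A B)
  case 0
  have "?P A B 0 = {[]}" by auto
  then show ?case by simp
next
  case (Suc m)
  define S where "S = Sigma (?P B A m) (\<lambda>ys. A - set ys)"
  have fin: "finite (?P C D i)" if "finite C" "finite D" for C D i
    by (rule finite_subset[OF _ finite_lists_length_eq[of "C \<union> D" i]]) (use that in auto)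
  \<comment> \<open>A tail starts in \<open>B\<close>, so the induction hypothesis is used with the
    two sides exchanged.\<close>
  have "(card B - L) ^ ((m + 1) div 2) * (card A - L) ^ (m div 2) \<le> card (?P B A m)"
  proof (rule Suc.IH)
    show "{b, a} \<in> E" if "b \<in> B" "a \<in> A" for a b
      using Suc.prems(3)[OF that(2,1)] by (simp add: insert_commute)
  qed (use Suc.prems in auto)
  then have "(card A - L) * ((card B - L) ^ ((m + 1) div 2) * (card A - L) ^ (m div 2))
      \<le> (card A - L) * card (?P B A m)" by (rule mult_left_mono) simp
  also have "\<dots> = (\<Sum>ys\<in>?P B A m. card A - L)" by simp
  also have "\<dots> \<le> (\<Sum>ys\<in>?P B A m. card (A - set ys))"
  proof (rule sum_mono)
    fix ys assume "ys \<in> ?P B A m"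
    then have "card (set ys) \<le> L" using Suc.prems(4) card_length[of ys] by auto
    then show "card A - L \<le> card (A - set ys)" using diff_card_le_card_Diff[of "set ys" A] by simp
  qed
  also have "\<dots> = card S" unfolding S_def using fin Suc.prems by simp
  also have "\<dots> = card ((\<lambda>(ys, x). x # ys) ` S)"
    by (rule card_image[symmetric]) (auto simp: inj_on_def)
  also have "\<dots> \<le> card (?P A B (Suc m))"
  proof (rule card_mono)
    show "(\<lambda>(ys, x). x # ys) ` S \<subseteq> ?P A B (Suc m)"
    proof clarify
      fix ys x assume "(ys, x) \<in> S"
      then have *: "length ys = m" "distinct ys" "set ys \<subseteq> B \<union> A" "list_edges ys \<subseteq> E"
        "ys \<noteq> [] \<longrightarrow> hd ys \<in> B" "x \<in> A" "x \<notin> set ys" by (auto simp: S_def)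
      \<comment> \<open>If \<open>ys\<close> is nonempty, its head lies in \<open>B\<close>, so the
        new first edge joins \<open>A\<close> to \<open>B\<close>.\<close>
      have "list_edges (x # ys) \<subseteq> E" using * Suc.prems(3) by (cases ys) auto
      then show "length (x # ys) = Suc m \<and> distinct (x # ys) \<and> set (x # ys) \<subseteq> A \<union> B \<and>
          list_edges (x # ys) \<subseteq> E \<and> (x # ys \<noteq> [] \<longrightarrow> hd (x # ys) \<in> A)" using * by auto
    qed
  qed (use fin Suc.prems in auto)
  finally show ?case by (simp add: mult_ac)
qed

text \<open>Path lists starting in \<open>A\<close> and those starting in \<open>B\<close> are
  disjoint families, and their lower bounds add up.\<close>

lemma num_path_copies_bipartite_ge:
  assumes V: "finite (verts G)" and l: "l \<ge> 2" and "A \<subseteq> verts G" "B \<subseteq> verts G" "A \<inter> B = {}"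
    "\<And>a b. a \<in> A \<Longrightarrow> b \<in> B \<Longrightarrow> {a, b} \<in> edges G"
  shows "((card A - l) * (card B - l)) ^ (l div 2)
      * (if even l then 2 else (card A - l) + (card B - l))
    \<le> 2 * num_copies (path_graph l) G"
proof -
  define P where "P C D = {xs. length xs = l \<and> distinct xs \<and> set xs \<subseteq> C \<union> D
    \<and> list_edges xs \<subseteq> edges G \<and> (xs \<noteq> [] \<longrightarrow> hd xs \<in> C)}" for C D
  have fin: "finite A" "finite B" using V assms finite_subset by blast+
  have sub: "P A B \<subseteq> path_lists G l" "P B A \<subseteq> path_lists G l"
    using assms by (auto simp: P_def path_lists_def)
  then have finP: "finite (P A B)" "finite (P B A)"
    using finite_path_lists[OF V] finite_subset by blast+
  let ?a = "card A - l" and ?b = "card B - l"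
  have AB: "?a ^ ((l + 1) div 2) * ?b ^ (l div 2) \<le> card (P A B)"
    unfolding P_def using assms fin by (intro card_alternating_paths_ge) auto
  have BA: "?b ^ ((l + 1) div 2) * ?a ^ (l div 2) \<le> card (P B A)"
    unfolding P_def
  proof (rule card_alternating_paths_ge)
    show "{b, a} \<in> edges G" if "b \<in> B" "a \<in> A" for a b
      using assms(6)[OF that(2,1)] by (simp add: insert_commute)
  qed (use fin in auto)
  \<comment> \<open>For even \<open>l\<close> both summands are equal; for odd \<open>l\<close> each
    has one surplus factor, \<open>a\<close> or \<open>b\<close>.\<close>
  have "(a * b) ^ (l div 2) * (if even l then 2 else a + b)
      = a ^ ((l + 1) div 2) * b ^ (l div 2) + b ^ ((l + 1) div 2) * a ^ (l div 2)" for a b :: nat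
    by (cases "even l") (auto elim!: evenE oddE simp: power_mult_distrib algebra_simps)
  then have "(?a * ?b) ^ (l div 2) * (if even l then 2 else ?a + ?b) \<le> card (P A B) + card (P B A)"
    using add_mono[OF AB BA] by simp
  moreover have "P A B \<inter> P B A = {}" using assms(5) l by (auto simp: P_def)
  then have "card (P A B) + card (P B A) = card (P A B \<union> P B A)"
    using finP by (simp add: card_Un_disjoint)
  moreover have "card (P A B \<union> P B A) \<le> card (path_lists G l)"
    using sub finite_path_lists[OF V] by (intro card_mono) auto
  ultimately show ?thesis unfolding two_mult_num_path_copies[OF V l] by (simp only:)
qed

section \<open>The extremal graph\<close>

context
  fixes n e :: nat
  assumes n: "n \<ge> 2" and e: "4 * e \<le> n ^ 2"
begin

text \<open>The product of the two halves is the integer part of \<open>n ^ 2 / 4\<close>. This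
  supplies the witness that makes the least element in \<open>B_t\<close> meaningful.\<close>

lemma half_admissible: "0 < n div 2 \<and> e \<le> (n div 2) * (n - n div 2)"
proof -
  have "e \<le> (n div 2) * (n - n div 2)"
  proof (cases "even n")
    case True
    then show ?thesis using e by (auto elim!: evenE simp: power2_eq_square)
  next
    case False
    then obtain k where "n = 2 * k + 1" by (auto elim: oddE)
    then show ?thesis using e by (auto simp: power2_eq_square algebra_simps)
  qed
  then show ?thesis using n by simp
qed

lemma B_t_props: "0 < B_t n e" "e \<le> B_t n e * (n - B_t n e)" "B_t n e \<le> n div 2"
  using LeastI[of "\<lambda>i. 0 < i \<and> e \<le> i * (n - i)", OF half_admissible]
    Least_le[of "\<lambda>i. 0 < i \<and> e \<le> i * (n - i)", OF half_admissible]
  by (auto simp: B_t_def)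

text \<open>With \<open>t = B_t n e\<close>, minimality gives
  \<open>(t - 1) * (n - t + 1) < e\<close>, hence \<open>(t - 1) * (n - t) \<le> e\<close>: at most
  \<open>n - t\<close> edges are surplus, no more than the chosen vertex has.\<close>

lemma deleted_edges_le: "B_t n e * (n - B_t n e) - e \<le> n - B_t n e"
\<comment> \<open>For \<open>t = 1\<close> minimality says nothing about the excluded index 0, but
  there the claim is immediate.\<close>
proof (cases "B_t n e = 1")
  case False
  define s where "s = B_t n e - 1"
  have s: "B_t n e = Suc s" "s > 0" using False B_t_props(1) by (auto simp: s_def)
  have "\<not> (0 < s \<and> e \<le> s * (n - s))"
    by (rule not_less_Least) (use s in \<open>simp add: B_t_def\<close>)
  then have "s * (n - s) < e" using s by simp
  moreover have "s * (n - Suc s) \<le> s * (n - s)" by (intro mult_le_mono2) simp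
  ultimately have "s * (n - Suc s) \<le> e" by linarith
  then show ?thesis using s by (simp add: le_diff_conv)
qed simp

lemma card_edges_B_graph: "card (edges (B_graph n e)) = e"
proof -
  define t where "t = B_t n e"
  note t = B_t_props[folded t_def] deleted_edges_le[folded t_def]
  define K where "K = {{a, b} | a b. a < t \<and> t \<le> b \<and> b < n}"
  define R where "R = {{0, t + j} | j. j < t * (n - t) - e}"
  have K: "K = (\<lambda>(a, b). {a, b}) ` ({..<t} \<times> {t..<n})" by (auto simp: K_def) blast
  have "inj_on (\<lambda>(a, b). {a, b}) ({..<t} \<times> {t..<n})"
    by (auto simp: inj_on_def doubleton_eq_iff)
  then have cK: "card K = t * (n - t)" unfolding K by (simp add: card_image card_cartesian_product)
  have R: "R = (\<lambda>j. {0, t + j}) ` {..<t * (n - t) - e}" by (auto simp: R_def)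
  have "inj_on (\<lambda>j. {0, t + j}) {..<t * (n - t) - e}"
    by (auto simp: inj_on_def doubleton_eq_iff)
  then have cR: "card R = t * (n - t) - e" unfolding R by (simp add: card_image)
  \<comment> \<open>The bound on the number of deletions keeps \<open>t + j\<close> below
    \<open>n\<close>, so every deleted pair really is an edge.\<close>
  have "R \<subseteq> K"
  proof
    fix X assume "X \<in> R"
    then obtain j where "X = {0, t + j}" "j < t * (n - t) - e" by (auto simp: R_def)
    then have "X = {0, t + j} \<and> 0 < t \<and> t \<le> t + j \<and> t + j < n" using t by linarith
    then show "X \<in> K" unfolding K_def by blast
  qed
  then have "card (K - R) = e" using cK cR t by (subst card_Diff_subset) (auto simp: R)
  then show ?thesis by (simp add: B_graph_def Let_def K_def R_def t_def)
qed

lemma verts_B_graph: "verts (B_graph n e) = {..<n}"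
  by (simp add: B_graph_def Let_def)

lemma edges_B_graph_bipartite:
  "X \<in> edges (B_graph n e) \<Longrightarrow> \<exists>a b. X = {a, b} \<and> a < B_t n e \<and> B_t n e \<le> b \<and> b < n"
  by (auto simp: B_graph_def Let_def)

lemma simple_graph_B_graph: "simple_graph (B_graph n e)"
  unfolding simple_graph_def verts_B_graph
  by (auto dest!: edges_B_graph_bipartite simp: nsets_def card_insert_if)

text \<open>Every edge has exactly one end below \<open>B_t n e\<close>, and three vertices cannot
  lie pairwise on opposite sides.\<close>

lemma graph_free_B_graph: "graph_free (complete_graph 3) (B_graph n e)"
  unfolding graph_free_def
proof
  assume "\<exists>G'. subgraph G' (B_graph n e) \<and> graph_iso (complete_graph 3) G'"
  then obtain G' f where G': "edges G' \<subseteq> edges (B_graph n e)"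
    and E: "edges G' = (\<lambda>X. f ` X) ` nsets {..<3::nat} 2"
    by (auto simp: subgraph_def graph_iso_def complete_graph_def)
  have cross: "f i < B_t n e \<longleftrightarrow> \<not> f j < B_t n e" if "i < 3" "j < 3" "i \<noteq> j" for i j
  proof -
    have "{i, j} \<in> nsets {..<3::nat} 2" using that by (auto simp: nsets_def)
    then have "f ` {i, j} \<in> edges (B_graph n e)" using G' E by blast
    then show ?thesis by (auto dest!: edges_B_graph_bipartite simp: doubleton_eq_iff)
  qed
  show False using cross[of 0 1] cross[of 1 2] cross[of 0 2] by simp
qed

lemma B_graph_in_free_graphs: "B_graph n e \<in> free_graphs n e (complete_graph 3)"
  using simple_graph_B_graph graph_free_B_graph card_edges_B_graph
  by (simp add: free_graphs_def verts_B_graph)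

text \<open>All deleted edges meet vertex 0. Dropping it leaves a complete bipartite graph with
  sides of sizes \<open>B_t n e - 1\<close> and \<open>n - B_t n e\<close>.\<close>

lemma num_path_copies_B_graph_ge:
  assumes "l \<ge> 2"
  shows "((B_t n e - 1 - l) * (n - B_t n e - l)) ^ (l div 2)
      * (if even l then 2 else (B_t n e - 1 - l) + (n - B_t n e - l))
    \<le> 2 * num_copies (path_graph l) (B_graph n e)"
proof -
  have edge: "{a, b} \<in> edges (B_graph n e)" if "a \<in> {1..<B_t n e}" "b \<in> {B_t n e..<n}" for a b
    using that by (auto simp: B_graph_def Let_def doubleton_eq_iff)
  have "((card {1..<B_t n e} - l) * (card {B_t n e..<n} - l)) ^ (l div 2)
      * (if even l then 2 else (card {1..<B_t n e} - l) + (card {B_t n e..<n} - l))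
    \<le> 2 * num_copies (path_graph l) (B_graph n e)"
    by (rule num_path_copies_bipartite_ge[OF _ assms _ _ _ edge])
      (use B_t_props(3) n in \<open>auto simp: verts_B_graph\<close>)
  then show ?thesis by (simp only: card_atLeastLessThan)
qed

lemma num_path_copies_B_graph_le_ex_count:
  "num_copies (path_graph l) (B_graph n e) \<le> ex_count n e (path_graph l) (complete_graph 3)"
  unfolding ex_count_def
  by (intro Max_ge finite_num_copies_free_graphs imageI B_graph_in_free_graphs)

text \<open>Since \<open>B_graph n e\<close> is admissible, the maximum is over a nonempty set and
  is attained by some graph, to which the triangle-free bound applies.\<close>

lemma ex_count_path_triangle_le:
  assumes "l \<ge> 2"
  shows "2 * ex_count n e (path_graph l) (complete_graph 3)
    \<le> e ^ (l div 2) * (if even l then 2 else n)"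
proof -
  have "ex_count n e (path_graph l) (complete_graph 3)
      \<in> num_copies (path_graph l) ` free_graphs n e (complete_graph 3)"
    unfolding ex_count_def
    using B_graph_in_free_graphs by (intro Max_in finite_num_copies_free_graphs) auto
  then obtain G where "G \<in> free_graphs n e (complete_graph 3)"
    "ex_count n e (path_graph l) (complete_graph 3) = num_copies (path_graph l) G" by blast
  then show ?thesis
    using num_path_copies_triangle_free_le[OF _ _ assms, of G] by (auto simp: free_graphs_def)
qed

end

section \<open>Asymptotic comparison of the upper and lower bounds\<close>

theorem theorem4p1:
  fixes l :: nat and e :: "nat \<Rightarrow> nat"
  assumes "l \<ge> 2"
    and "filterlim (\<lambda>n. real (e n) / real n) at_top sequentially"
    and "\<forall>\<^sub>F n in sequentially. real (e n) \<le> (real n)\<^sup>2 / 4"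
  shows "(\<lambda>n. real (ex_count n (e n) (path_graph l) (complete_graph 3)))
           \<sim>[sequentially] (\<lambda>n. real (num_copies (path_graph l) (B_graph n (e n))))"
proof -
  define t where "t n = B_t n (e n)" for n
  define k where "k = l div 2"
  define f where "f n = real (ex_count n (e n) (path_graph l) (complete_graph 3))" for n
  define g where "g n = real (num_copies (path_graph l) (B_graph n (e n)))" for n
  \<comment> \<open>\<open>c\<close> and \<open>d\<close> are the parity factors of the upper and
    lower bounds. For odd \<open>l\<close>, \<open>d n\<close> is \<open>a n + b n\<close>, in which
    \<open>t n\<close> cancels.\<close>
  define c where "c n = (if even l then 2 else real n)" for n
  define d where "d n = (if even l then 2 else real n - 1 - 2 * real l)" for n
  define a where "a n = real (t n) - 1 - real l" for n
  define b where "b n = real (n - t n) - real l" for n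
  have ev: "\<forall>\<^sub>F n in sequentially. n \<ge> 2 \<and> 4 * e n \<le> n ^ 2"
    using assms(3) eventually_ge_at_top[of 2]
  proof eventually_elim
    case (elim n)
    then have "real (4 * e n) \<le> real (n ^ 2)" by simp
    then show ?case using elim(2) by (simp only: of_nat_le_iff)
  qed
  have t_lim: "filterlim (\<lambda>n. real (t n)) at_top sequentially"
  proof (rule filterlim_at_top_mono[OF assms(2)])
    \<comment> \<open>From \<open>e n \<le> t n * (n - t n) \<le> t n * n\<close>.\<close>
    show "\<forall>\<^sub>F n in sequentially. real (e n) / real n \<le> real (t n)"
      using ev
    proof eventually_elim
      case (elim n)
      have "e n \<le> t n * (n - t n)" using B_t_props(2)[of n "e n"] elim by (simp add: t_def)
      also have "\<dots> \<le> t n * n" by simp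
      finally have "real (e n) \<le> real (t n) * real n" by (metis of_nat_le_iff of_nat_mult)
      then show ?case using elim by (simp add: divide_le_eq)
    qed
  qed
  have s_lim: "filterlim (\<lambda>n. real (n - t n)) at_top sequentially"
  proof (rule filterlim_at_top_mono)
    show "filterlim (\<lambda>n. real n / 2) at_top sequentially" by real_asymp
    show "\<forall>\<^sub>F n in sequentially. real n / 2 \<le> real (n - t n)"
      using ev
    proof eventually_elim
      case (elim n)
      then have "t n \<le> n div 2" using B_t_props(3)[of n "e n"] by (simp add: t_def)
      then show ?case by linarith
    qed
  qed
  have "((\<lambda>x::real. x / (x - 1 - real l)) \<longlongrightarrow> 1) at_top"
    and "((\<lambda>x::real. x / (x - real l)) \<longlongrightarrow> 1) at_top" by real_asymp+
  then have ratio: "(\<lambda>n. real (t n) / a n) \<longlonglongrightarrow> 1" "(\<lambda>n. real (n - t n) / b n) \<longlonglongrightarrow> 1"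
    unfolding a_def b_def using t_lim s_lim filterlim_compose by blast+
  have "(\<lambda>n. real n / (real n - 1 - 2 * real l)) \<longlonglongrightarrow> 1" by real_asymp
  then have "(\<lambda>n. c n / d n) \<longlonglongrightarrow> 1" by (cases "even l") (simp_all add: c_def d_def)
  then have "(\<lambda>n. ((real (t n) / a n) * (real (n - t n) / b n)) ^ k * (c n / d n)) \<longlonglongrightarrow> (1 * 1) ^ k * 1"
    using ratio by (intro tendsto_intros)
  then have upper: "(\<lambda>n. ((real (t n) / a n) * (real (n - t n) / b n)) ^ k * (c n / d n)) \<longlonglongrightarrow> 1"
    by simp
  \<comment> \<open>The quotient is squeezed between 1, as \<open>B_graph\<close> is itself a
    competitor, and the upper bound for \<open>f\<close> over the lower bound for
    \<open>g\<close>.\<close>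
  have "\<forall>\<^sub>F n in sequentially. 1 \<le> f n / g n
      \<and> f n / g n \<le> ((real (t n) / a n) * (real (n - t n) / b n)) ^ k * (c n / d n)"
    using ev filterlim_at_top_dense[THEN iffD1, OF t_lim, rule_format, of "1 + real l"]
      filterlim_at_top_dense[THEN iffD1, OF s_lim, rule_format, of "real l"]
  proof eventually_elim
    case (elim n)
    note B = B_t_props[of n "e n", folded t_def]
    have tn: "t n \<le> n" using B(3) elim by linarith
    \<comment> \<open>Beyond the thresholds \<open>1 + l\<close> for \<open>t n\<close> and
      \<open>l\<close> for \<open>n - t n\<close>, the truncated differences agree with the real
      ones and are positive.\<close>
    have ab: "real (t n - Suc l) = a n" "real (n - (t n + l)) = b n" "a n > 0" "b n > 0"
      using elim by (auto simp: a_def b_def of_nat_diff)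
    have dab: "d n = (if even l then 2 else a n + b n)"
      using tn by (auto simp: d_def a_def b_def of_nat_diff)
    have d: "d n > 0" using ab dab by simp
    have "real (((t n - 1 - l) * (n - t n - l)) ^ k
        * (if even l then 2 else (t n - 1 - l) + (n - t n - l)))
      \<le> real (2 * num_copies (path_graph l) (B_graph n (e n)))"
      unfolding of_nat_le_iff t_def k_def using elim assms(1) by (intro num_path_copies_B_graph_ge) auto
    then have lower_g: "(a n * b n) ^ k * d n \<le> 2 * g n"
      by (simp add: ab dab g_def split: if_splits)
    have "real (2 * ex_count n (e n) (path_graph l) (complete_graph 3))
      \<le> real (e n ^ k * (if even l then 2 else n))"
      unfolding of_nat_le_iff k_def using elim assms(1) by (intro ex_count_path_triangle_le) auto
    then have "2 * f n \<le> real (e n) ^ k * c n" by (simp add: f_def c_def split: if_splits)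
    also have "\<dots> \<le> (real (t n) * real (n - t n)) ^ k * c n"
      using B(2) elim by (intro mult_right_mono power_mono)
        (auto simp: c_def simp flip: of_nat_mult simp del: of_nat_diff)
    finally have upper_f: "2 * f n \<le> (real (t n) * real (n - t n)) ^ k * c n" .
    have pos: "0 < (a n * b n) ^ k * d n" using ab d by simp
    have fg: "g n \<le> f n"
      unfolding f_def g_def of_nat_le_iff using elim by (intro num_path_copies_B_graph_le_ex_count) auto
    have g: "g n > 0" using pos lower_g by linarith
    \<comment> \<open>Both sides are doubled because the bounds count lists, two per path.\<close>
    have "f n / g n = (2 * f n) / (2 * g n)" by simp
    also have "\<dots> \<le> ((real (t n) * real (n - t n)) ^ k * c n) / ((a n * b n) ^ k * d n)"
      using upper_f lower_g pos g fg by (intro frac_le) auto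
    also have "\<dots> = ((real (t n) / a n) * (real (n - t n) / b n)) ^ k * (c n / d n)"
      by (simp add: power_mult_distrib power_divide)
    finally show ?case using fg g by simp
  qed
  then have "(\<lambda>n. f n / g n) \<longlonglongrightarrow> 1"
    by (intro tendsto_sandwich[OF _ _ tendsto_const upper]) (auto elim: eventually_mono)
  then show ?thesis unfolding f_def g_def by (rule asymp_equivI')
qed

end
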